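(* Let $n\ge 3$ be an integer and $m=2^{n-1}+2^{n-3}$. The diameter of the bipartite mixed graph $BDM(2,m)$ is $k=2n$.
   Context: A mixed graph may contain undirected edges and directed edges (arcs). The distance from $u$ to $v$ is the length of a shortest path from $u$ to $v$, where edges may be traversed in both directions and arcs only along their orientation; the diameter is the maximum distance over all ordered pairs of vertices. For $m=2^{n-1}+2^{n-3}$, the mixed graph $BDM(2,m)$ has $4m$ vertices, denoted $(\alpha,i)_\beta$ with $\alpha,\beta\in\{0,1\}$ and $i\in\mathbb{Z}_m$, with independent sets $V_\beta=\{(0,i)_\beta,(1,i)_\beta: i\in\mathbb{Z}_m\}$ for $\beta=0,1$. For every $i\in\mathbb{Z}_m$ (arithmetic modulo $m$) it has the edges $$(0,i)_0\sim(0,i)_1,\qquad (1,i)_0\sim(1,i)_1,$$ and the arcs $$(0,i)_0\to(1,2i)_1,\quad (0,i)_1\to(1,2i+1)_0,\quad (1,i)_0\to(0,-2i-1)_1,\quad (1,i)_1\to(0,-2i-2)_0 .$$ *)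

theory Defs
  imports Main "HOL-Library.Extended_Nat"
begin

section \<open>Mixed graphs\<close>

record 'a mixed_graph =
  verts :: "'a set"
  edges :: "'a set set"
  arcs :: "('a \<times> 'a) set"

definition wf_mixed_graph :: "'a mixed_graph \<Rightarrow> bool" where
  "wf_mixed_graph G \<longleftrightarrow>
     (\<forall>e \<in> edges G. e \<subseteq> verts G \<and> card e = 2) \<and> arcs G \<subseteq> verts G \<times> verts G"

definition mixed_independent :: "'a mixed_graph \<Rightarrow> 'a set \<Rightarrow> bool" where
  "mixed_independent G V \<longleftrightarrow> (\<forall>u \<in> V. \<forall>v \<in> V. {u, v} \<notin> edges G \<and> (u, v) \<notin> arcs G)"

definition mixed_bipartition :: "'a mixed_graph \<Rightarrow> 'a set \<Rightarrow> 'a set \<Rightarrow> bool" where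
  "mixed_bipartition G V W \<longleftrightarrow>
     V \<union> W = verts G \<and> V \<inter> W = {} \<and> mixed_independent G V \<and> mixed_independent G W"

definition mixed_step :: "'a mixed_graph \<Rightarrow> 'a \<Rightarrow> 'a \<Rightarrow> bool" where
  "mixed_step G u v \<longleftrightarrow> {u, v} \<in> edges G \<or> (u, v) \<in> arcs G"

text \<open>A path is given by its list of vertices, so its length is one less than the length of the list.\<close>

definition mixed_path :: "'a mixed_graph \<Rightarrow> 'a \<Rightarrow> 'a list \<Rightarrow> 'a \<Rightarrow> bool" where
  "mixed_path G u p v \<longleftrightarrow>
     p \<noteq> [] \<and> hd p = u \<and> last p = v \<and> set p \<subseteq> verts G \<and> distinct p \<and> successively (mixed_step G) p"

text \<open>The distance is infinite if there is no path.\<close>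

definition mixed_distance :: "'a mixed_graph \<Rightarrow> 'a \<Rightarrow> 'a \<Rightarrow> enat" where
  "mixed_distance G u v = (INF p \<in> {p. mixed_path G u p v}. enat (length p - 1))"

text \<open>On a finite nonempty vertex set the supremum is a maximum; it is infinite as soon as
  some vertex cannot be reached from another one.\<close>

definition mixed_diameter :: "'a mixed_graph \<Rightarrow> enat" where
  "mixed_diameter G = (SUP (u, v) \<in> verts G \<times> verts G. mixed_distance G u v)"

section \<open>The mixed graphs \<open>BDM(2,m)\<close>\<close>

text \<open>The triple \<open>(\<alpha>, i, \<beta>)\<close> stands for the vertex $(\alpha,i)_\beta$; the elements of
  $\mathbb{Z}_m$ are represented by the integers \<open>0, \<dots>, m - 1\<close>.\<close>

type_synonym bdm_vertex = "nat \<times> int \<times> nat"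

definition BDM_part :: "nat \<Rightarrow> nat \<Rightarrow> bdm_vertex set" where
  "BDM_part m \<beta> = {(\<alpha>, i, \<beta>) | \<alpha> i. \<alpha> \<in> {0, 1} \<and> i \<in> {0..<int m}}"

definition BDM :: "nat \<Rightarrow> bdm_vertex mixed_graph" where
  "BDM m =
     \<lparr> verts = BDM_part m 0 \<union> BDM_part m 1,
       edges = (\<Union>i \<in> {0..<int m}.
         {{(0, i, 0), (0, i, 1)},
          {(1, i, 0), (1, i, 1)}}),
       arcs = (\<Union>i \<in> {0..<int m}.
         {((0, i, 0), (1, (2 * i) mod int m, 1)),
          ((0, i, 1), (1, (2 * i + 1) mod int m, 0)),
          ((1, i, 0), (0, (- 2 * i - 1) mod int m, 1)),
          ((1, i, 1), (0, (- 2 * i - 2) mod int m, 0))}) \<rparr>"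

lemma wf_BDM: "wf_mixed_graph (BDM m)"
  by (auto simp: wf_mixed_graph_def BDM_def BDM_part_def)

lemma bipartition_BDM: "mixed_bipartition (BDM m) (BDM_part m 0) (BDM_part m 1)"
  by (auto simp: mixed_bipartition_def mixed_independent_def BDM_def BDM_part_def doubleton_eq_iff)

lemma card_verts_BDM: "card (verts (BDM m)) = 4 * m"
proof -
  have "verts (BDM m) = {0, 1} \<times> {0..<int m} \<times> {0, 1}"
    by (auto simp: BDM_def BDM_part_def)
  then show ?thesis
    by (simp add: card_cartesian_product)
qed

end

theory Submission
  imports Defs
begin

text \<open>
  Doubling \<open>m\<close> increases the diameter by exactly two, so everything reduces to \<open>m = 5\<close>.
  Reduction modulo \<open>m\<close> maps \<open>BDM(2,2m)\<close> onto \<open>BDM(2,m)\<close>, walks can be lifted along it, and two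
  vertices of \<open>BDM(2,2m)\<close> have the same out-arc head if and only if they have the same
  reduction. Moreover exactly one end of every edge of \<open>BDM(2,2m)\<close> is the head of an arc. Hence a
  vertex is reached by a lifted walk to the reduction of an arc tail, followed by the arc and at most
  one edge; and for the end of the edge that is not the head of an arc, no shorter way exists.
\<close>

section \<open>Distances and walks\<close>

text \<open>Paths have distinct vertices, relation powers need not. If the last step returns to a
  vertex already on the path, cutting the path off there keeps it distinct and only shortens
  it.\<close>

lemma mixed_path_of_walk:
  assumes "wf_mixed_graph G" "u \<in> verts G" "(mixed_step G ^^ l) u v"
  shows "\<exists>p. mixed_path G u p v \<and> length p - 1 \<le> l"
  using assms(3)
proof (induction l arbitrary: v)
  case 0
  then have "mixed_path G u [u] v"
    using assms(2) by (simp add: mixed_path_def)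
  then show ?case by fastforce
next
  case (Suc l)
  then obtain w where w: "(mixed_step G ^^ l) u w" "mixed_step G w v" by auto
  from Suc.IH[OF w(1)] obtain p where p: "mixed_path G u p w" "length p - 1 \<le> l" by blast
  have v: "v \<in> verts G"
    using w(2) assms(1) by (auto simp: mixed_step_def wf_mixed_graph_def)
  show ?case
  proof (cases "v \<in> set p")
    case True
    then obtain xs ys where "p = xs @ v # ys" by (auto simp: in_set_conv_decomp)
    then have "mixed_path G u (xs @ [v]) v" "length (xs @ [v]) - 1 \<le> Suc l"
      using p by (auto simp: mixed_path_def successively_append_iff hd_append split: if_splits)
    then show ?thesis by blast
  next
    case False
    then have "mixed_path G u (p @ [v]) v" "length (p @ [v]) - 1 \<le> Suc l"
      using p v w(2) by (auto simp: mixed_path_def successively_append_iff)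
    then show ?thesis by blast
  qed
qed

lemma walk_of_successively:
  assumes "successively (mixed_step G) p" "p \<noteq> []"
  shows "(mixed_step G ^^ (length p - 1)) (hd p) (last p)"
  using assms
proof (induction p rule: rev_induct)
  case (snoc x p)
  show ?case
  proof (cases "p = []")
    case False
    then obtain k where k: "length p = Suc k" by (cases p) auto
    have "(mixed_step G ^^ k) (hd p) (last p)" "mixed_step G (last p) x"
      using snoc False k by (auto simp: successively_append_iff)
    then show ?thesis using False k by auto
  qed simp
qed simp

lemma mixed_distance_le:
  assumes "wf_mixed_graph G" "u \<in> verts G" "(mixed_step G ^^ l) u v"
  shows "mixed_distance G u v \<le> enat l"
proof -
  obtain p where "mixed_path G u p v" "length p - 1 \<le> l"
    using mixed_path_of_walk[OF assms] by blast
  then show ?thesis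
    unfolding mixed_distance_def by (intro INF_lower2[of p]) auto
qed

text \<open>The bound is an \<open>enat\<close> because \<open>mixed_distance_double_ge\<close>
  applies it to a distance plus two that is not known to be finite.\<close>

lemma mixed_distance_ge:
  assumes "\<And>l. (mixed_step G ^^ l) u v \<Longrightarrow> c \<le> enat l"
  shows "c \<le> mixed_distance G u v"
  unfolding mixed_distance_def
proof (rule INF_greatest)
  fix p assume "p \<in> {p. mixed_path G u p v}"
  then show "c \<le> enat (length p - 1)"
    using assms walk_of_successively[of G p] by (auto simp: mixed_path_def)
qed

text \<open>A finite infimum comes from a nonempty set of paths, and a nonempty set of extended
  naturals contains its infimum.\<close>

lemma mixed_distance_eq_enatD:
  assumes "mixed_distance G u v = enat l"
  shows "(mixed_step G ^^ l) u v"
proof -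
  let ?A = "(\<lambda>p. enat (length p - 1)) ` {p. mixed_path G u p v}"
  have inf: "Inf ?A = enat l"
    using assms by (simp add: mixed_distance_def)
  then have "?A \<noteq> {}" by (metis Inf_enat_def enat.distinct(1))
  then have "Inf ?A \<in> ?A"
    unfolding Inf_enat_def by (metis (mono_tags, lifting) LeastI ex_in_conv)
  then obtain p where "mixed_path G u p v" "length p - 1 = l"
    unfolding inf by auto
  then show ?thesis
    using walk_of_successively[of G p] by (auto simp: mixed_path_def)
qed

section \<open>Steps of \<open>BDM(2,m)\<close>\<close>

text \<open>Every vertex lies on exactly one edge and is the tail of exactly one arc, so both kinds
  of step become functions, and walks can be lifted and enumerated step by step.\<close>

fun across :: "bdm_vertex \<Rightarrow> bdm_vertex" where
  "across (a, i, b) = (a, i, 1 - b)"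

fun arc_head :: "nat \<Rightarrow> bdm_vertex \<Rightarrow> bdm_vertex" where
  "arc_head m (a, i, b) =
     (1 - a, (if a = 0 then 2 * i + int b else - 2 * i - 1 - int b) mod int m, 1 - b)"

fun reduce :: "nat \<Rightarrow> bdm_vertex \<Rightarrow> bdm_vertex" where
  "reduce m (a, i, b) = (a, i mod int m, b)"

lemma verts_BDM: "verts (BDM m) = {0, 1} \<times> {0..<int m} \<times> {0, 1}"
  by (auto simp: BDM_def BDM_part_def)

lemma mixed_step_BDM:
  assumes "u \<in> verts (BDM m)"
  shows "mixed_step (BDM m) u v \<longleftrightarrow> v = across u \<or> v = arc_head m u"
  using assms
  by (auto simp: mixed_step_def BDM_def BDM_part_def doubleton_eq_iff algebra_simps)

lemma across_in_verts: "u \<in> verts (BDM m) \<Longrightarrow> across u \<in> verts (BDM m)"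
  by (auto simp: verts_BDM)

lemma arc_head_in_verts: "u \<in> verts (BDM m) \<Longrightarrow> arc_head m u \<in> verts (BDM m)"
  by (auto simp: verts_BDM)

lemma walk_in_verts:
  assumes "u \<in> verts (BDM m)" "(mixed_step (BDM m) ^^ l) u v"
  shows "v \<in> verts (BDM m)"
  using assms(2)
proof (induction l arbitrary: v)
  case (Suc l)
  then obtain w where "(mixed_step (BDM m) ^^ l) u w" "mixed_step (BDM m) w v" by auto
  moreover from this have "w \<in> verts (BDM m)" using Suc.IH by blast
  ultimately show ?case
    using across_in_verts arc_head_in_verts by (simp add: mixed_step_BDM) metis
qed (use assms(1) in simp)

lemma across_across: "u \<in> verts (BDM m) \<Longrightarrow> across (across u) = u"
  by (auto simp: verts_BDM)

section \<open>Reduction modulo \<open>m\<close> and the heads of arcs\<close>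

lemma reduce_in_verts: "u \<in> verts (BDM (2 * m)) \<Longrightarrow> reduce m u \<in> verts (BDM m)"
  by (auto simp: verts_BDM)

lemma reduce_across: "reduce m (across u) = across (reduce m u)"
  by (cases u) auto

lemma reduce_arc_head: "reduce m (arc_head (2 * m) u) = arc_head m (reduce m u)"
proof -
  have "(- 2 * (i mod int m) - 1 - c) mod int m = (- 2 * i - 1 - c) mod int m" for i c
    by (intro mod_diff_cong mod_mult_cong) simp_all
  moreover have "(2 * (i mod int m) + c) mod int m = (2 * i + c) mod int m" for i c
    by (intro mod_add_cong mod_mult_cong) simp_all
  ultimately show ?thesis
    by (cases u) (simp add: mod_mod_cancel del: mult_minus_left)
qed

text \<open>Indices enter the arcs doubled, and \<open>2 * x\<close> and \<open>2 * y\<close> agree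
  modulo \<open>2 * m\<close> exactly when \<open>x\<close> and \<open>y\<close> agree modulo
  \<open>m\<close>.\<close>

lemma arc_head_eq_iff:
  assumes "u \<in> verts (BDM (2 * m))" "v \<in> verts (BDM (2 * m))"
  shows "arc_head (2 * m) u = arc_head (2 * m) v \<longleftrightarrow> reduce m u = reduce m v"
proof -
  have pos: "(2 * x + c) mod (2 * int m) = (2 * y + c) mod (2 * int m) \<longleftrightarrow> x mod int m = y mod int m"
    for x y c
  proof -
    have "(2 * x + c) - (2 * y + c) = 2 * (x - y)" by simp
    then show ?thesis
      unfolding mod_eq_dvd_iff by (simp only: dvd_mult_cancel_left) simp
  qed
  have neg: "(- 2 * x - 1 - c) mod (2 * int m) = (- 2 * y - 1 - c) mod (2 * int m)
      \<longleftrightarrow> x mod int m = y mod int m" for x y c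
  proof -
    have "(- 2 * x - 1 - c) - (- 2 * y - 1 - c) = 2 * (y - x)" by simp
    then show ?thesis
      unfolding mod_eq_dvd_iff dvd_diff_commute[of _ x y] by (simp only: dvd_mult_cancel_left) simp
  qed
  obtain a i b a' i' b' where eq: "u = (a, i, b)" "v = (a', i', b')"
    by (cases u, cases v) auto
  have range: "a \<in> {0, 1}" "a' \<in> {0, 1}" "b \<in> {0, 1}" "b' \<in> {0, 1}"
    using assms by (auto simp: verts_BDM eq)
  show ?thesis
  proof (cases "a = a' \<and> b = b'")
    case True
    then show ?thesis
      using pos[of i b i'] neg[of i b i'] by (simp add: eq del: mult_minus_left)
  next
    case False
    \<comment> \<open>Truncated subtraction makes \<open>1 - a\<close> injective only on {0,
      1}.\<close>
    then show ?thesis using range by (auto simp: eq)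
  qed
qed

lemma arc_head_cases:
  assumes "v \<in> verts (BDM (2 * m))"
  obtains u where "u \<in> verts (BDM (2 * m))" "v = arc_head (2 * m) u \<or> v = across (arc_head (2 * m) u)"
proof -
  obtain a i b where v: "v = (a, i, b)" "a \<in> {0, 1}" "0 \<le> i" "i < 2 * int m" "b \<in> {0, 1}"
    using assms by (auto simp: verts_BDM)
  \<comment> \<open>For \<open>a = 1\<close> the tail solves \<open>2 * j + c = i\<close>; for
    \<open>a = 0\<close> it solves \<open>2 * j + c = 2 * m - 1 - i\<close>. The remainder
    \<open>c\<close> prescribes the side of the tail, so the head may land on the side opposite to
    \<open>v\<close>, which one edge repairs.\<close>
  define c j where "c = (if a = 1 then i mod 2 else (i + 1) mod 2)"
    and "j = (if a = 1 then i div 2 else (2 * int m - 1 - i) div 2)"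
  have j: "0 \<le> j" "j < 2 * int m" and c: "c = 0 \<or> c = 1"
    using v by (auto simp: j_def c_def)
  define u where "u = (1 - a, j, nat c)"
  have u: "u \<in> verts (BDM (2 * m))"
    using v j c by (auto simp: u_def verts_BDM)
  have "(- 2 * j - 1 - c) mod (2 * int m) = i" if "a = 0"
  proof -
    have "- 2 * j - 1 - c = i + (- 1) * (2 * int m)"
      using that by (simp add: j_def c_def) presburger
    then show ?thesis using v by (simp only: mod_mult_self1) simp
  qed
  moreover have "(2 * j + c) mod (2 * int m) = i" if "a = 1"
    using that v by (simp add: j_def c_def)
  ultimately have "arc_head (2 * m) u = (a, i, 1 - nat c)"
    using v c by (auto simp: u_def)
  then have "v = arc_head (2 * m) u \<or> v = across (arc_head (2 * m) u)"
    using v c by auto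
  with u show ?thesis using that by blast
qed

text \<open>Parity of an index makes sense modulo \<open>2 * m\<close>, and the index of a head is
  even exactly when its tail \<open>(a, i, b)\<close> has \<open>a = b\<close>. If both ends of an
  edge were heads, their tails would agree in \<open>a\<close> and differ in \<open>b\<close>, so
  the common index would have both parities.\<close>

lemma arc_head_neq_across_arc_head:
  assumes "u \<in> verts (BDM (2 * m))" "v \<in> verts (BDM (2 * m))"
  shows "arc_head (2 * m) u \<noteq> across (arc_head (2 * m) v)"
proof -
  have even: "even (x mod (2 * int m)) \<longleftrightarrow> even x" for x
    by (rule dvd_mod_iff) simp
  have parity: "even (fst (snd (arc_head (2 * m) w))) \<longleftrightarrow> (fst w = 0 \<longleftrightarrow> snd (snd w) = 0)"
    if wv: "w \<in> verts (BDM (2 * m))" for w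
  proof -
    obtain a i b where w: "w = (a, i, b)" "a = 0 \<or> a = 1" "b = 0 \<or> b = 1"
      using wv by (cases w) (auto simp: verts_BDM)
    have "even (2 * i + int b) \<longleftrightarrow> b = 0" "even (- 2 * i - 1 - int b) \<longleftrightarrow> b \<noteq> 0"
      using w(3) by auto
    then show ?thesis
      using w(2) by (auto simp only: w(1) arc_head.simps fst_conv snd_conv of_nat_mult of_nat_numeral even
          simp_thms if_True if_False zero_neq_one one_neq_zero)
  qed
  show ?thesis
  proof
    assume eq: "arc_head (2 * m) u = across (arc_head (2 * m) v)"
    then have "fst u = fst v" "snd (snd u) \<noteq> snd (snd v)"
      using assms by (auto simp: verts_BDM)
    moreover have range: "snd (snd u) \<in> {0, 1}" "snd (snd v) \<in> {0, 1}"
      using assms by (auto simp: verts_BDM)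
    moreover have "fst (snd (arc_head (2 * m) u)) = fst (snd (arc_head (2 * m) v))"
      using eq by (cases "arc_head (2 * m) v") simp
    ultimately show False
      using parity[OF assms(1)] parity[OF assms(2)] range by auto
  qed
qed

section \<open>Doubling\<close>

lemma walk_reduce:
  assumes "u \<in> verts (BDM (2 * m))" "(mixed_step (BDM (2 * m)) ^^ l) u v"
  shows "(mixed_step (BDM m) ^^ l) (reduce m u) (reduce m v)"
  using assms(2)
proof (induction l arbitrary: v)
  case (Suc l)
  then obtain w where w: "(mixed_step (BDM (2 * m)) ^^ l) u w" "mixed_step (BDM (2 * m)) w v"
    by auto
  have "w \<in> verts (BDM (2 * m))"
    using walk_in_verts[OF assms(1) w(1)] .
  then have "mixed_step (BDM m) (reduce m w) (reduce m v)"
    using w(2) by (auto simp: mixed_step_BDM reduce_in_verts reduce_across reduce_arc_head)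
  then show ?case using Suc.IH[OF w(1)] by auto
qed simp

text \<open>Both step functions commute with \<open>reduce m\<close>, so the same sequence of edges
  and arcs can be followed from \<open>u\<close>; only the reduction of the end is
  prescribed.\<close>

lemma walk_lift:
  assumes "u \<in> verts (BDM (2 * m))" "(mixed_step (BDM m) ^^ l) (reduce m u) w"
  shows "\<exists>v. reduce m v = w \<and> (mixed_step (BDM (2 * m)) ^^ l) u v"
  using assms(2)
proof (induction l arbitrary: w)
  case (Suc l)
  then obtain x where x: "(mixed_step (BDM m) ^^ l) (reduce m u) x" "mixed_step (BDM m) x w"
    by auto
  from Suc.IH[OF x(1)] obtain y where
    y: "reduce m y = x" "(mixed_step (BDM (2 * m)) ^^ l) u y" by blast
  have yv: "y \<in> verts (BDM (2 * m))"
    using walk_in_verts[OF assms(1) y(2)] .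
  then have "w = across (reduce m y) \<or> w = arc_head m (reduce m y)"
    using x(2) mixed_step_BDM[OF reduce_in_verts] by (simp add: y(1)[symmetric])
  moreover have "mixed_step (BDM (2 * m)) y (across y)"
      "mixed_step (BDM (2 * m)) y (arc_head (2 * m) y)"
    by (simp_all add: mixed_step_BDM[OF yv])
  ultimately show ?case
    using relpowp_Suc_I[OF y(2)] reduce_across reduce_arc_head by metis
next
  case 0
  then show ?case by (intro exI[of _ u]) simp
qed

lemma mixed_distance_double_le:
  assumes u: "u \<in> verts (BDM (2 * m))" and v: "v \<in> verts (BDM (2 * m))"
  shows "\<exists>s \<in> verts (BDM m).
    mixed_distance (BDM (2 * m)) u v \<le> mixed_distance (BDM m) (reduce m u) s + 2"
proof -
  obtain w where w: "w \<in> verts (BDM (2 * m))"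
      "v = arc_head (2 * m) w \<or> v = across (arc_head (2 * m) w)"
    using arc_head_cases[OF v] by blast
  have "mixed_distance (BDM (2 * m)) u v \<le> mixed_distance (BDM m) (reduce m u) (reduce m w) + 2"
  proof (cases "mixed_distance (BDM m) (reduce m u) (reduce m w)")
    case (enat l)
    obtain x where x: "reduce m x = reduce m w" "(mixed_step (BDM (2 * m)) ^^ l) u x"
      using walk_lift[OF u mixed_distance_eq_enatD[OF enat]] by blast
    have xv: "x \<in> verts (BDM (2 * m))"
      using walk_in_verts[OF u x(2)] .
    \<comment> \<open>The lift may miss \<open>w\<close>, but \<open>x\<close> has the same
      reduction, hence the same arc head.\<close>
    have head: "arc_head (2 * m) x = arc_head (2 * m) w"
      using arc_head_eq_iff[OF xv w(1)] x(1) by simp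
    have 1: "(mixed_step (BDM (2 * m)) ^^ Suc l) u (arc_head (2 * m) w)"
      using relpowp_Suc_I[OF x(2)] mixed_step_BDM[OF xv] head by simp
    have 2: "(mixed_step (BDM (2 * m)) ^^ Suc (Suc l)) u (across (arc_head (2 * m) w))"
      using relpowp_Suc_I[OF 1] mixed_step_BDM[OF arc_head_in_verts[OF w(1)]] by simp
    have "mixed_distance (BDM (2 * m)) u v \<le> enat (Suc (Suc l))"
      using w(2) mixed_distance_le[OF wf_BDM u 1] mixed_distance_le[OF wf_BDM u 2]
      by (metis enat_ord_simps(1) le_SucI order_refl order_trans)
    also have "\<dots> = enat l + 2" by (simp add: numeral_eq_enat)
    finally show ?thesis using enat by simp
  qed simp
  then show ?thesis using w(1) reduce_in_verts by blast
qed

text \<open>The remote target is \<open>across t\<close>, where \<open>t\<close> is the head of the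
  arc from \<open>s\<close>: it can be entered only from \<open>t\<close>, and \<open>t\<close> only
  from \<open>across t\<close> or by an arc from a vertex reducing to \<open>s\<close>.\<close>

lemma mixed_distance_double_ge:
  assumes u: "u \<in> verts (BDM m)" and s: "s \<in> verts (BDM m)"
  shows "\<exists>u' \<in> verts (BDM (2 * m)). \<exists>v \<in> verts (BDM (2 * m)).
    mixed_distance (BDM m) u s + 2 \<le> mixed_distance (BDM (2 * m)) u' v"
proof -
  have s2: "s \<in> verts (BDM (2 * m))" "reduce m s = s"
    using s by (auto simp: verts_BDM)
  define t where "t = arc_head (2 * m) s"
  have t: "t \<in> verts (BDM (2 * m))" "across t \<in> verts (BDM (2 * m))"
    using s2 by (auto simp: t_def arc_head_in_verts across_in_verts)
  \<comment> \<open>The two preimages of \<open>u\<close> differ in their index, while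
    \<open>t\<close> and \<open>across t\<close> share theirs, so one preimage avoids both. This
    excludes walks of length zero in the induction below.\<close>
  have "\<exists>x \<in> verts (BDM (2 * m)). reduce m x = u \<and> x \<noteq> t \<and> x \<noteq> across t"
  proof -
    obtain a i b a' i' b' where eq: "u = (a, i, b)" "t = (a', i', b')"
      by (cases u, cases t) auto
    show ?thesis
      using u unfolding eq
      by (intro bexI[of _ "(a, if i = i' then i + int m else i, b)"]) (auto simp: verts_BDM)
  qed
  then obtain x where x: "x \<in> verts (BDM (2 * m))" "reduce m x = u" "x \<noteq> t" "x \<noteq> across t"
    by blast
  \<comment> \<open>Both claims are proved together, as a walk may cross the edge of
    \<open>t\<close> back and forth. The bound \<open>k<l\<close> counts the arc into
    \<open>t\<close>, and \<open>k + 2 \<le> l\<close> also the edge.\<close>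
  have walk: "((mixed_step (BDM (2 * m)) ^^ l) x t \<longrightarrow> (\<exists>k<l. (mixed_step (BDM m) ^^ k) u s)) \<and>
     ((mixed_step (BDM (2 * m)) ^^ l) x (across t) \<longrightarrow> (\<exists>k. k + 2 \<le> l \<and> (mixed_step (BDM m) ^^ k) u s))"
    for l
  proof (induction l)
    case (Suc l)
    have "\<exists>k<Suc l. (mixed_step (BDM m) ^^ k) u s"
      if step: "(mixed_step (BDM (2 * m)) ^^ Suc l) x t"
    proof -
      obtain w where w: "(mixed_step (BDM (2 * m)) ^^ l) x w" "mixed_step (BDM (2 * m)) w t"
        using step by (elim relpowp_Suc_E)
      have wv: "w \<in> verts (BDM (2 * m))"
        using walk_in_verts[OF x(1) w(1)] .
      from w(2) consider "t = across w" | "t = arc_head (2 * m) w"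
        unfolding mixed_step_BDM[OF wv] by blast
      then show ?thesis
      proof cases
        case 1
        then have "w = across t" using across_across[OF wv] by simp
        then obtain k where "k + 2 \<le> l" "(mixed_step (BDM m) ^^ k) u s"
          using Suc.IH w(1) by blast
        then show ?thesis by (intro exI[of _ k]) auto
      next
        case 2
        then have "reduce m w = s"
          using arc_head_eq_iff[OF wv s2(1)] s2(2) by (simp add: t_def)
        then show ?thesis
          using walk_reduce[OF x(1) w(1)] x(2) by auto
      qed
    qed
    moreover have "\<exists>k. k + 2 \<le> Suc l \<and> (mixed_step (BDM m) ^^ k) u s"
      if step: "(mixed_step (BDM (2 * m)) ^^ Suc l) x (across t)"
    proof -
      obtain w where w: "(mixed_step (BDM (2 * m)) ^^ l) x w" "mixed_step (BDM (2 * m)) w (across t)"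
        using step by (elim relpowp_Suc_E)
      have wv: "w \<in> verts (BDM (2 * m))"
        using walk_in_verts[OF x(1) w(1)] .
      \<comment> \<open>\<open>across t\<close> is not the head of an arc, so the last step crosses
        the edge from \<open>t\<close>.\<close>
      have "across t = across w"
        using w(2) arc_head_neq_across_arc_head[OF wv s2(1)]
        unfolding mixed_step_BDM[OF wv] t_def by metis
      then have "w = t" using across_across[OF wv] across_across[OF t(1)] by metis
      then obtain k where "k < l" "(mixed_step (BDM m) ^^ k) u s"
        using Suc.IH w(1) by blast
      then show ?thesis by (intro exI[of _ k]) auto
    qed
    ultimately show ?case by blast
  qed (use x(3,4) in simp)
  have "mixed_distance (BDM m) u s + 2 \<le> mixed_distance (BDM (2 * m)) x (across t)"
  proof (rule mixed_distance_ge)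
    fix l assume "(mixed_step (BDM (2 * m)) ^^ l) x (across t)"
    then obtain k where k: "k + 2 \<le> l" "(mixed_step (BDM m) ^^ k) u s"
      using walk by blast
    have "mixed_distance (BDM m) u s + 2 \<le> enat k + 2"
      using mixed_distance_le[OF wf_BDM u k(2)] by (rule add_right_mono)
    also have "\<dots> \<le> enat l" using k(1) by (simp add: numeral_eq_enat)
    finally show "mixed_distance (BDM m) u s + 2 \<le> enat l" .
  qed
  then show ?thesis using x(1) t(2) by blast
qed

section \<open>From distances to the diameter\<close>

lemma mixed_distance_le_diameter:
  "u \<in> verts G \<Longrightarrow> v \<in> verts G \<Longrightarrow> mixed_distance G u v \<le> mixed_diameter G"
  using SUP_upper[of "(u, v)" "verts G \<times> verts G" "\<lambda>(u, v). mixed_distance G u v"]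
  by (simp add: mixed_diameter_def)

lemma mixed_diameter_le_iff:
  "mixed_diameter G \<le> c \<longleftrightarrow> (\<forall>u \<in> verts G. \<forall>v \<in> verts G. mixed_distance G u v \<le> c)"
  by (simp add: mixed_diameter_def SUP_le_iff split_paired_Ball_Sigma)

lemma mixed_diameter_BDM_double:
  assumes "m > 0"
  shows "mixed_diameter (BDM (2 * m)) = mixed_diameter (BDM m) + 2"
proof (rule antisym)
  show "mixed_diameter (BDM (2 * m)) \<le> mixed_diameter (BDM m) + 2"
    unfolding mixed_diameter_le_iff[of "BDM (2 * m)"]
  proof (intro ballI)
    fix u v assume u: "u \<in> verts (BDM (2 * m))" and v: "v \<in> verts (BDM (2 * m))"
    obtain s where s: "s \<in> verts (BDM m)"
        "mixed_distance (BDM (2 * m)) u v \<le> mixed_distance (BDM m) (reduce m u) s + 2"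
      using mixed_distance_double_le[OF u v] by blast
    have "mixed_distance (BDM m) (reduce m u) s + 2 \<le> mixed_diameter (BDM m) + 2"
      by (intro add_right_mono mixed_distance_le_diameter reduce_in_verts u s(1))
    then show "mixed_distance (BDM (2 * m)) u v \<le> mixed_diameter (BDM m) + 2"
      using s(2) by order
  qed
next
  have *: "mixed_distance (BDM m) u v + 2 \<le> mixed_diameter (BDM (2 * m))"
    if uv: "u \<in> verts (BDM m)" "v \<in> verts (BDM m)" for u v
  proof -
    obtain u' v' where "u' \<in> verts (BDM (2 * m))" "v' \<in> verts (BDM (2 * m))"
        "mixed_distance (BDM m) u v + 2 \<le> mixed_distance (BDM (2 * m)) u' v'"
      using mixed_distance_double_ge[OF uv] by blast
    then show ?thesis
      using mixed_distance_le_diameter[of u' "BDM (2 * m)" v'] by (blast intro: order_trans)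
  qed
  show "mixed_diameter (BDM m) + 2 \<le> mixed_diameter (BDM (2 * m))"
  proof (cases "mixed_diameter (BDM (2 * m))")
    case (enat d)
    \<comment> \<open>Subtracting two from \<open>d\<close> is not truncated, as any pair of
      vertices forces \<open>2 \<le> d\<close>; \<open>m > 0\<close> supplies such a pair.\<close>
    have le: "mixed_distance (BDM m) u v \<le> enat (d - 2) \<and> 2 \<le> d"
      if "u \<in> verts (BDM m)" "v \<in> verts (BDM m)" for u v
      using *[OF that] enat
      by (cases "mixed_distance (BDM m) u v") (auto simp: numeral_eq_enat)
    have "(0, 0, 0) \<in> verts (BDM m)" using assms by (simp add: verts_BDM)
    then have "2 \<le> d" using le by blast
    have "mixed_diameter (BDM m) \<le> enat (d - 2)"
      using le by (simp add: mixed_diameter_le_iff)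
    then have "mixed_diameter (BDM m) + 2 \<le> enat (d - 2) + 2" by (rule add_right_mono)
    also have "\<dots> = enat d" using \<open>2 \<le> d\<close> by (simp add: numeral_eq_enat)
    finally show ?thesis using enat by simp
  qed simp
qed

section \<open>The case \<open>m = 5\<close>\<close>

text \<open>An executable enumeration of the ends of walks of exact length; \<open>remdups\<close>
  keeps the lists from doubling at every step.\<close>

fun walk_ends :: "nat \<Rightarrow> nat \<Rightarrow> bdm_vertex \<Rightarrow> bdm_vertex list" where
  "walk_ends m 0 u = [u]"
| "walk_ends m (Suc l) u =
     remdups (concat (map (\<lambda>v. [across v, arc_head m v]) (walk_ends m l u)))"

lemma set_walk_ends:
  assumes "u \<in> verts (BDM m)"
  shows "set (walk_ends m l u) = {v. (mixed_step (BDM m) ^^ l) u v}"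
proof (induction l)
  case (Suc l)
  have "(mixed_step (BDM m) ^^ Suc l) u v \<longleftrightarrow>
      (\<exists>w. (mixed_step (BDM m) ^^ l) u w \<and> (v = across w \<or> v = arc_head m w))" for v
    unfolding relpowp.simps relcompp_apply using walk_in_verts[OF assms] mixed_step_BDM by blast
  then show ?case using Suc by (auto simp del: relpowp.simps across.simps arc_head.simps split_paired_Ex)
qed simp

lemma mixed_diameter_BDM_5: "mixed_diameter (BDM 5) = 6"
proof (rule antisym)
  have verts: "verts (BDM 5) = set (List.product [0, 1] (List.product [0, 1, 2, 3, 4] [0, 1]))"
  proof -
    have "{0..<int 5} = {0, 1, 2, 3, 4}" by auto
    then show ?thesis by (simp add: verts_BDM)
  qed
  \<comment> \<open>Every step changes the side, so length 6 serves the vertices on the side of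
    \<open>u\<close> and length 5 the others. Shorter walks are covered, since crossing an edge back
    and forth adds two steps.\<close>
  have "\<forall>u \<in> set (List.product [0, 1] (List.product [0, 1, 2, 3, 4] [0, 1])).
      \<forall>v \<in> set (List.product [0, 1] (List.product [0, 1, 2, 3, 4] [0, 1])).
        v \<in> set (walk_ends 5 5 u) \<or> v \<in> set (walk_ends 5 6 u)"
    by code_simp
  then have *: "(mixed_step (BDM 5) ^^ 5) u v \<or> (mixed_step (BDM 5) ^^ 6) u v"
    if "u \<in> verts (BDM 5)" "v \<in> verts (BDM 5)" for u v
    using that set_walk_ends[of u 5] unfolding verts by blast
  show "mixed_diameter (BDM 5) \<le> 6"
    unfolding mixed_diameter_le_iff
  proof (intro ballI)
    fix u v assume uv: "u \<in> verts (BDM 5)" "v \<in> verts (BDM 5)"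
    then have "mixed_distance (BDM 5) u v \<le> enat 5 \<or> mixed_distance (BDM 5) u v \<le> enat 6"
      using *[OF uv] mixed_distance_le[OF wf_BDM uv(1)] by blast
    then show "mixed_distance (BDM 5) u v \<le> 6"
      by (auto simp: numeral_eq_enat intro: order_trans)
  qed
  \<comment> \<open>These two vertices are at distance six, so the upper bound is attained.\<close>
  have "\<forall>l \<in> set [0..<6]. (1, 3, 0) \<notin> set (walk_ends 5 l (0, 0, 0))"
    by code_simp
  moreover have u: "(0, 0, 0) \<in> verts (BDM 5)" and v: "(1, 3, 0) \<in> verts (BDM 5)"
    by (auto simp: verts_BDM)
  ultimately have "6 \<le> l" if "(mixed_step (BDM 5) ^^ l) (0, 0, 0) (1, 3, 0)" for l
    using that set_walk_ends[OF u, of l] by force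
  then have "6 \<le> mixed_distance (BDM 5) (0, 0, 0) (1, 3, 0)"
    by (intro mixed_distance_ge) (simp add: numeral_eq_enat)
  then show "6 \<le> mixed_diameter (BDM 5)"
    using mixed_distance_le_diameter[OF u v] by order
qed

text \<open>Since \<open>m = 5 * 2 ^ (n - 3)\<close>, starting from diameter 6 at
  \<open>m = 5\<close>, \<open>n - 3\<close> doublings give
  \<open>6 + 2 * (n - 3) = 2 * n\<close>.\<close>

theorem proposition3p2:
  fixes n m :: nat
  assumes "n \<ge> 3"
    and "m = 2 ^ (n - 1) + 2 ^ (n - 3)"
  shows "mixed_diameter (BDM m) = enat (2 * n)"
proof -
  have diam: "mixed_diameter (BDM (5 * 2 ^ j)) = enat (2 * (j + 3))" for j
  proof (induction j)
    case 0
    show ?case using mixed_diameter_BDM_5 by (simp add: numeral_eq_enat)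
  next
    case (Suc j)
    then show ?case
      using mixed_diameter_BDM_double[of "5 * 2 ^ j"] by (simp add: ac_simps numeral_eq_enat)
  qed
  obtain j where j: "n = j + 3"
    using assms(1) by (metis le_add_diff_inverse2)
  have "m = 5 * 2 ^ j"
    using assms(2) by (simp add: j power_add)
  then show ?thesis using diam[of j] j by simp
qed

end
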